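(* Let $G$ be a unicyclic graph with $n \geq 4$ vertices. For $0 \leq \alpha < 1$, $\gamma_\alpha(G) \leq \gamma_\alpha(S_n + e)$, with equality if and only if $G \cong S_n + e$.
   Context: All graphs are finite, simple and undirected. For a graph $G$, $A(G)$ is its adjacency matrix and $D(G)$ the diagonal matrix of vertex degrees. For $\alpha\in[0,1]$, $A_\alpha(G) = \alpha D(G) + (1-\alpha)A(G)$, $\rho_\alpha(G)$ is the largest eigenvalue of $A_\alpha(G)$, and $\gamma_\alpha(G) = \Delta(G) - \rho_\alpha(G)$ where $\Delta(G)$ is the maximum degree of $G$. A unicyclic graph is a connected graph with exactly one cycle. For $n\ge 3$, $S_n + e$ is the graph obtained from the star $S_n$ on $n$ vertices by adding an edge joining two of its vertices of degree one. *)

theory Defs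
  imports "Graph_Theory.Graph_Theory" "Jordan_Normal_Form.Char_Poly"
begin

text \<open>
  Finite simple undirected graphs are the \<^locale>\<open>pair_graph\<close>s of the library, i.e. finite,
  loop-free, symmetric digraphs; an undirected edge is a pair of opposite arcs, so the degree of a
  vertex is its out-degree.
\<close>

definition max_degree :: "'a pair_pre_digraph \<Rightarrow> nat" where
  "max_degree G = Max (out_degree (with_proj G) ` pverts G)"

text \<open>
  Matrices are indexed by \<open>0..<n\<close>, so the vertices are enumerated by an arbitrary but fixed list;
  another enumeration conjugates the matrices below by a permutation matrix and leaves their
  eigenvalues unchanged.
\<close>

definition vertex_list :: "'a pair_pre_digraph \<Rightarrow> 'a list" where
  "vertex_list G = (SOME vs. distinct vs \<and> set vs = pverts G)"

lemma vertex_list: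
  assumes "finite (pverts G)"
  shows "distinct (vertex_list G)" and "set (vertex_list G) = pverts G"
proof -
  have "\<exists>vs. distinct vs \<and> set vs = pverts G"
    using finite_distinct_list[OF assms] by blast
  then have "distinct (vertex_list G) \<and> set (vertex_list G) = pverts G"
    unfolding vertex_list_def by (rule someI_ex)
  then show "distinct (vertex_list G)" and "set (vertex_list G) = pverts G"
    by auto
qed

definition adjacency_matrix :: "'a pair_pre_digraph \<Rightarrow> real mat" where
  "adjacency_matrix G = (let vs = vertex_list G; n = card (pverts G) in
     mat n n (\<lambda>(i, j). if (vs ! i, vs ! j) \<in> parcs G then 1 else 0))"

definition degree_matrix :: "'a pair_pre_digraph \<Rightarrow> real mat" where
  "degree_matrix G = (let vs = vertex_list G; n = card (pverts G) in
     mat n n (\<lambda>(i, j). if i = j then real (out_degree (with_proj G) (vs ! i)) else 0))"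

definition A_alpha :: "real \<Rightarrow> 'a pair_pre_digraph \<Rightarrow> real mat" where
  "A_alpha \<alpha> G = \<alpha> \<cdot>\<^sub>m degree_matrix G + (1 - \<alpha>) \<cdot>\<^sub>m adjacency_matrix G"

definition rho_alpha :: "real \<Rightarrow> 'a pair_pre_digraph \<Rightarrow> real" where
  "rho_alpha \<alpha> G = Max {k. eigenvalue (A_alpha \<alpha> G) k}"

definition gamma_alpha :: "real \<Rightarrow> 'a pair_pre_digraph \<Rightarrow> real" where
  "gamma_alpha \<alpha> G = real (max_degree G) - rho_alpha \<alpha> G"

text \<open>
  The closed walks counted as cycles by the library include \<open>u, v, u\<close>, and each undirected cycle
  arises from several of them (starting point, direction). A cycle of an undirected graph is
  therefore represented by its set of undirected edges, and has length at least 3.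
\<close>

definition undirected_cycles :: "'a pair_pre_digraph \<Rightarrow> 'a set set set" where
  "undirected_cycles G =
     {(\<lambda>(u, v). {u, v}) ` set p | p. pre_digraph.cycle (with_proj G) p \<and> 3 \<le> length p}"

definition unicyclic :: "'a pair_pre_digraph \<Rightarrow> bool" where
  "unicyclic G \<longleftrightarrow> pair_graph G \<and> Digraph_Component.connected (with_proj G) \<and>
     (\<exists>!C. C \<in> undirected_cycles G)"

definition star_graph :: "nat \<Rightarrow> nat pair_pre_digraph" where
  "star_graph n = \<lparr>pverts = {0..<n}, parcs = {0} \<times> {1..<n} \<union> {1..<n} \<times> {0}\<rparr>"

text \<open>
  The centre of the star is \<open>0\<close>; the vertices \<open>1\<close> and \<open>2\<close> are leaves of it for \<open>n \<ge> 3\<close>.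
\<close>

definition star_plus_edge :: "nat \<Rightarrow> nat pair_pre_digraph" where
  "star_plus_edge n =
     \<lparr>pverts = pverts (star_graph n), parcs = parcs (star_graph n) \<union> {(1, 2), (2, 1)}\<rparr>"

end

theory Submission
  imports Defs "HOL-Analysis.Function_Topology"
begin

text \<open>
  The quadratic form of \<open>A\<^sub>\<alpha>(G)\<close> is the sum of \<open>x\<^sub>u\<^sup>2 + x\<^sub>v\<^sup>2 - (1 - \<alpha>)(x\<^sub>u - x\<^sub>v)\<^sup>2\<close> over the
  edges \<open>uv\<close>, so adding pairwise disjoint edges raises \<open>\<rho>\<^sub>\<alpha>\<close> by at most \<open>1\<close>. As the maximum degree of
  a star grows by \<open>1\<close> with each new leaf, \<open>\<gamma>\<^sub>\<alpha>(S\<^sub>m)\<close> is nondecreasing in \<open>m\<close>; and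
  \<open>\<gamma>\<^sub>\<alpha>(S\<^sub>n\<^sub>-\<^sub>1) < \<gamma>\<^sub>\<alpha>(S\<^sub>n + e)\<close> because \<open>S\<^sub>n + e\<close> arises from \<open>S\<^sub>n\<^sub>-\<^sub>1\<close> and an isolated vertex by
  adding two disjoint edges. A graph of maximum degree \<open>\<Delta>\<close> contains \<open>S\<^sub>\<Delta>\<^sub>+\<^sub>1\<close>, so
  \<open>\<gamma>\<^sub>\<alpha>(G) \<le> \<gamma>\<^sub>\<alpha>(S\<^sub>\<Delta>\<^sub>+\<^sub>1)\<close>, which settles \<open>\<Delta> \<le> n - 2\<close> with strict inequality. If \<open>\<Delta> = n - 1\<close>, each
  edge avoiding the dominating vertex closes a triangle with it, and unicyclicity leaves exactly
  one such edge.
\<close>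

section \<open>The largest eigenvalue of a real symmetric matrix\<close>

lemma compact_coordinate_sphere:
  fixes V :: "'a set"
  assumes "finite V"
  shows "compact {g :: 'a \<Rightarrow> real. (\<forall>v. v \<notin> V \<longrightarrow> g v = 0) \<and> (\<Sum>v\<in>V. (g v)\<^sup>2) = 1}"
proof -
  define box where "box = (\<Pi>\<^sub>E v\<in>(UNIV :: 'a set). if v \<in> V then {-1..1 :: real} else {0})"
  define normalized where "normalized = (\<lambda>g :: 'a \<Rightarrow> real. \<Sum>v\<in>V. (g v)\<^sup>2) -` {1}"
  have "compactin (product_topology (\<lambda>_. euclidean) UNIV) box"
    unfolding box_def by (subst compactin_PiE) auto
  then have "compact box"
    by (simp add: euclidean_product_topology)
  moreover have "closed normalized"
    unfolding normalized_def
    by (intro closed_vimage continuous_intros continuous_on_product_coordinates)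
  ultimately have "compact (box \<inter> normalized)"
    by (rule compact_Int_closed)
  moreover have "\<bar>g v\<bar> \<le> 1" if "(\<Sum>v\<in>V. (g v)\<^sup>2) = 1" "v \<in> V" for g :: "'a \<Rightarrow> real" and v
    using member_le_sum[OF \<open>v \<in> V\<close>, of "\<lambda>v. (g v)\<^sup>2"] that assms by (simp add: abs_square_le_1)
  then have "{g :: 'a \<Rightarrow> real. (\<forall>v. v \<notin> V \<longrightarrow> g v = 0) \<and> (\<Sum>v\<in>V. (g v)\<^sup>2) = 1} = box \<inter> normalized"
    by (fastforce simp: box_def normalized_def PiE_iff abs_le_iff split: if_splits)
  ultimately show ?thesis
    by simp
qed

lemma scalar_prod_self_eq_sum_squares:
  fixes v :: "real vec"
  assumes "v \<in> carrier_vec n"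
  shows "v \<bullet> v = (\<Sum>i\<in>{0..<n}. (v $ i)\<^sup>2)"
  using assms by (simp add: scalar_prod_def power2_eq_square)

lemma quadratic_form_attains_max_on_sphere:
  fixes A :: "real mat"
  assumes "A \<in> carrier_mat n n" and "0 < n"
  obtains u where "u \<in> carrier_vec n" "u \<bullet> u = 1"
    "\<And>v. v \<in> carrier_vec n \<Longrightarrow> v \<bullet> v = 1 \<Longrightarrow> v \<bullet> (A *\<^sub>v v) \<le> u \<bullet> (A *\<^sub>v u)"
proof -
  define Q where "Q v = v \<bullet> (A *\<^sub>v v)" for v
  define S where "S = {g. (\<forall>i. i \<notin> {0..<n} \<longrightarrow> g i = 0) \<and> (\<Sum>i\<in>{0..<n}. (g i)\<^sup>2) = (1 :: real)}"
  have "(\<lambda>i. if i = 0 then 1 else 0) \<in> S"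
    using \<open>0 < n\<close> by (simp add: S_def if_distrib[of "\<lambda>x. x\<^sup>2"] cong: if_cong)
  then have "S \<noteq> {}"
    by blast
  moreover have "Q (vec n g) = (\<Sum>i\<in>{0..<n}. g i * (\<Sum>j\<in>{0..<n}. A $$ (i, j) * g j))" for g
    using assms(1) by (simp add: Q_def scalar_prod_def)
  then have "continuous_on S (\<lambda>g. Q (vec n g))"
    by (simp only:)
      (intro continuous_intros continuous_on_subset[OF continuous_on_product_coordinates]; simp)
  moreover have "compact S"
    unfolding S_def by (rule compact_coordinate_sphere) simp
  ultimately obtain g where g: "g \<in> S" and max: "\<And>h. h \<in> S \<Longrightarrow> Q (vec n h) \<le> Q (vec n g)"
    using continuous_attains_sup[of S "\<lambda>g. Q (vec n g)"] by metis
  have "Q v \<le> Q (vec n g)" if v: "v \<in> carrier_vec n" "v \<bullet> v = 1" for v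
  proof -
    define h where "h i = (if i < n then v $ i else 0)" for i
    have "vec n h = v"
      using v(1) by (auto simp: h_def)
    moreover have "h \<in> S"
      using v(2) by (simp add: S_def h_def scalar_prod_self_eq_sum_squares[OF v(1)])
    ultimately show ?thesis
      using max by metis
  qed
  moreover have "vec n g \<bullet> vec n g = 1"
    using g by (subst scalar_prod_self_eq_sum_squares[of _ n]) (auto simp: S_def)
  ultimately show ?thesis
    using that[of "vec n g"] by (simp add: Q_def)
qed

lemma Rayleigh_quotient_attains_max:
  fixes A :: "real mat"
  assumes A: "A \<in> carrier_mat n n" and "0 < n"
  obtains u where "u \<in> carrier_vec n" "u \<bullet> u = 1"
    "\<And>v. v \<in> carrier_vec n \<Longrightarrow> v \<bullet> (A *\<^sub>v v) \<le> u \<bullet> (A *\<^sub>v u) * (v \<bullet> v)"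
proof -
  obtain u where u: "u \<in> carrier_vec n" "u \<bullet> u = 1"
    and max: "\<And>v. v \<in> carrier_vec n \<Longrightarrow> v \<bullet> v = 1 \<Longrightarrow> v \<bullet> (A *\<^sub>v v) \<le> u \<bullet> (A *\<^sub>v u)"
    using quadratic_form_attains_max_on_sphere[OF assms] by blast
  have "v \<bullet> (A *\<^sub>v v) \<le> u \<bullet> (A *\<^sub>v u) * (v \<bullet> v)" if v: "v \<in> carrier_vec n" for v
  proof (cases "v = 0\<^sub>v n")
    case True
    then show ?thesis using A by (simp add: scalar_prod_left_zero[of _ n])
  next
    case False
    then have pos: "0 < v \<bullet> v"
      using conjugate_square_greater_0_vec[OF v] by simp
    define c where "c = 1 / sqrt (v \<bullet> v)"
    have c: "c * (c * (v \<bullet> v)) = 1"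
      using pos by (simp add: c_def)
    have "c * (c * (v \<bullet> (A *\<^sub>v v))) = (c \<cdot>\<^sub>v v) \<bullet> (A *\<^sub>v (c \<cdot>\<^sub>v v))"
      using v A by (simp add: mult_mat_vec)
    also have "\<dots> \<le> u \<bullet> (A *\<^sub>v u)"
      using v c by (intro max) simp_all
    finally have "c * (c * (v \<bullet> (A *\<^sub>v v))) * (v \<bullet> v) \<le> u \<bullet> (A *\<^sub>v u) * (v \<bullet> v)"
      using pos by (intro mult_right_mono) simp_all
    moreover have "c * (c * (v \<bullet> (A *\<^sub>v v))) * (v \<bullet> v) = v \<bullet> (A *\<^sub>v v)"
      using arg_cong[OF c, of "\<lambda>r. r * (v \<bullet> (A *\<^sub>v v))"] by (simp add: mult_ac)
    ultimately show ?thesis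
      by simp
  qed
  then show ?thesis
    using u that by blast
qed

lemma symmetric_quadratic_form_add_smult:
  fixes A :: "real mat"
  assumes A: "A \<in> carrier_mat n n" "transpose_mat A = A"
    and u: "u \<in> carrier_vec n" and w: "w \<in> carrier_vec n"
  shows "(u + t \<cdot>\<^sub>v w) \<bullet> (A *\<^sub>v (u + t \<cdot>\<^sub>v w)) =
    u \<bullet> (A *\<^sub>v u) + 2 * t * (w \<bullet> (A *\<^sub>v u)) + t\<^sup>2 * (w \<bullet> (A *\<^sub>v w))"
proof -
  have "u \<bullet> (A *\<^sub>v w) = w \<bullet> (A *\<^sub>v u)"
    using transpose_vec_mult_scalar[OF A(1) w u] comm_scalar_prod[OF w, of "A *\<^sub>v u"] A u by simp
  then show ?thesis
    using A(1) u w
    by (simp add: mult_add_distrib_mat_vec[OF A(1)] mult_mat_vec add_scalar_prod_distrib[of _ n]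
        scalar_prod_add_distrib[of _ n] power2_eq_square algebra_simps)
qed

lemma Rayleigh_quotient_maximizer_eigenvector:
  fixes A :: "real mat"
  assumes A: "A \<in> carrier_mat n n" "transpose_mat A = A"
    and u: "u \<in> carrier_vec n" "u \<bullet> (A *\<^sub>v u) = \<mu> * (u \<bullet> u)"
    and max: "\<And>v. v \<in> carrier_vec n \<Longrightarrow> v \<bullet> (A *\<^sub>v v) \<le> \<mu> * (v \<bullet> v)"
  shows "A *\<^sub>v u = \<mu> \<cdot>\<^sub>v u"
proof -
  define w where "w = A *\<^sub>v u - \<mu> \<cdot>\<^sub>v u"
  have w: "w \<in> carrier_vec n"
    using A(1) u(1) by (simp add: w_def)
  have w_w: "w \<bullet> w = w \<bullet> (A *\<^sub>v u) - \<mu> * (w \<bullet> u)"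
    using A(1) u(1) w scalar_prod_minus_distrib[of w n "A *\<^sub>v u" "\<mu> \<cdot>\<^sub>v u"]
    by (simp add: w_def[symmetric])
  define c where "c = \<mu> * (w \<bullet> w) - w \<bullet> (A *\<^sub>v w)"
  have first_order: "2 * t * (w \<bullet> w) \<le> t\<^sup>2 * c" for t
  proof -
    have "(u + t \<cdot>\<^sub>v w) \<bullet> (u + t \<cdot>\<^sub>v w) = u \<bullet> u + 2 * t * (w \<bullet> u) + t\<^sup>2 * (w \<bullet> w)"
      using symmetric_quadratic_form_add_smult[of "1\<^sub>m n" n u w t] u(1) w by simp
    then have "2 * t * (w \<bullet> (A *\<^sub>v u) - \<mu> * (w \<bullet> u)) \<le> t\<^sup>2 * c"
      using max[of "u + t \<cdot>\<^sub>v w"] u w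
      by (simp add: symmetric_quadratic_form_add_smult[OF A] c_def algebra_simps)
    then show ?thesis
      by (simp only: w_w)
  qed
  have "0 \<le> c"
    using max[OF w] by (simp add: c_def)
  define t where "t = (w \<bullet> w) / (c + 1)"
  have w_w_t: "w \<bullet> w = t * (c + 1)"
    using \<open>0 \<le> c\<close> by (simp add: t_def)
  have "t\<^sup>2 * (c + 2) \<le> 0"
    using first_order[of t] by (simp add: w_w_t power2_eq_square algebra_simps)
  then have "w \<bullet> w = 0"
    using \<open>0 \<le> c\<close> by (simp add: w_w_t mult_le_0_iff)
  then have "w = 0\<^sub>v n"
    using conjugate_square_eq_0_vec[OF w] by simp
  then show ?thesis
    using A(1) u(1) by (auto simp: w_def vec_eq_iff)
qed

lemma finite_eigenvalues:
  fixes A :: "'a :: field mat"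
  assumes "A \<in> carrier_mat n n"
  shows "finite {k. eigenvalue A k}"
proof -
  have "char_poly A \<noteq> 0"
    using degree_monic_char_poly[OF assms] by auto
  then show ?thesis
    by (simp add: eigenvalue_root_char_poly[OF assms] poly_roots_finite)
qed

lemma
  fixes A :: "real mat"
  assumes A: "A \<in> carrier_mat n n" "transpose_mat A = A" and "0 < n"
  shows eigenvalue_Max_symmetric: "eigenvalue A (Max {k. eigenvalue A k})"
    and quadratic_form_le_Max_eigenvalue:
      "v \<in> carrier_vec n \<Longrightarrow> v \<bullet> (A *\<^sub>v v) \<le> Max {k. eigenvalue A k} * (v \<bullet> v)"
proof -
  obtain u where u: "u \<in> carrier_vec n" "u \<bullet> u = 1"
    and max: "\<And>v. v \<in> carrier_vec n \<Longrightarrow> v \<bullet> (A *\<^sub>v v) \<le> u \<bullet> (A *\<^sub>v u) * (v \<bullet> v)"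
    using Rayleigh_quotient_attains_max[OF A(1) \<open>0 < n\<close>] by blast
  define \<mu> where "\<mu> = u \<bullet> (A *\<^sub>v u)"
  have "A *\<^sub>v u = \<mu> \<cdot>\<^sub>v u"
    using max u(2)
    by (intro Rayleigh_quotient_maximizer_eigenvector[OF A u(1)]) (simp_all add: \<mu>_def)
  moreover have "u \<noteq> 0\<^sub>v n"
    using u(2) by auto
  ultimately have \<mu>: "\<mu> \<in> {k. eigenvalue A k}"
    using A(1) u(1) by (auto simp: eigenvalue_def eigenvector_def)
  note finite = finite_eigenvalues[OF A(1)]
  show "eigenvalue A (Max {k. eigenvalue A k})"
    using Max_in[OF finite] \<mu> by blast
  have "\<mu> * (v \<bullet> v) \<le> Max {k. eigenvalue A k} * (v \<bullet> v)"
    using Max_ge[OF finite \<mu>] conjugate_square_ge_0_vec[of v] by (intro mult_right_mono) simp_all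
  then show "v \<bullet> (A *\<^sub>v v) \<le> Max {k. eigenvalue A k} * (v \<bullet> v)" if "v \<in> carrier_vec n"
    using max[OF that] by (simp add: \<mu>_def)
qed

section \<open>The quadratic form of a graph\<close>

definition alpha_form :: "real \<Rightarrow> ('a \<times> 'a) set \<Rightarrow> ('a \<Rightarrow> real) \<Rightarrow> real" where
  "alpha_form \<alpha> E x = (\<Sum>(u, v)\<in>E. \<alpha> * (x u)\<^sup>2 + (1 - \<alpha>) * x u * x v)"

lemma alpha_form_insert_edge:
  assumes "finite E" and "u \<noteq> v" and "(u, v) \<notin> E" and "(v, u) \<notin> E"
  shows "alpha_form \<alpha> (insert (u, v) (insert (v, u) E)) x =
    alpha_form \<alpha> E x + ((x u)\<^sup>2 + (x v)\<^sup>2 - (1 - \<alpha>) * (x u - x v)\<^sup>2)"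
  using assms by (simp add: alpha_form_def power2_eq_square algebra_simps)

lemma alpha_form_mono:
  assumes "finite F" and "E \<subseteq> F" and "0 \<le> \<alpha>" "\<alpha> \<le> 1" and "\<And>v. 0 \<le> x v"
  shows "alpha_form \<alpha> E x \<le> alpha_form \<alpha> F x"
  unfolding alpha_form_def using assms by (intro sum_mono2) auto

lemma alpha_form_le_abs:
  assumes "\<alpha> \<le> 1"
  shows "alpha_form \<alpha> E x \<le> alpha_form \<alpha> E (\<lambda>v. \<bar>x v\<bar>)"
  unfolding alpha_form_def
proof (intro sum_mono, clarify)
  fix u v
  have "(1 - \<alpha>) * (x u * x v) \<le> (1 - \<alpha>) * \<bar>x u * x v\<bar>"
    using assms by (intro mult_left_mono) auto
  then show "\<alpha> * (x u)\<^sup>2 + (1 - \<alpha>) * x u * x v \<le> \<alpha> * \<bar>x u\<bar>\<^sup>2 + (1 - \<alpha>) * \<bar>x u\<bar> * \<bar>x v\<bar>"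
    by (simp add: abs_mult mult.assoc)
qed

lemma alpha_form_image:
  assumes "inj_on h V" and "E \<subseteq> V \<times> V"
  shows "alpha_form \<alpha> (map_prod h h ` E) x = alpha_form \<alpha> E (x \<circ> h)"
proof -
  have "inj_on (map_prod h h) E"
    using map_prod_inj_on[OF assms(1) assms(1)] assms(2) by (rule inj_on_subset)
  then show ?thesis
    unfolding alpha_form_def by (simp add: sum.reindex case_prod_beta)
qed

lemma out_degree_with_proj: "out_degree (with_proj G) v = card {w. (v, w) \<in> parcs G}"
proof -
  have "out_arcs (with_proj G) v = Pair v ` {w. (v, w) \<in> parcs G}"
    by (auto simp: out_arcs_def)
  then show ?thesis
    by (simp add: out_degree_def card_image inj_on_def)
qed

definition alpha_weight :: "real \<Rightarrow> 'a pair_pre_digraph \<Rightarrow> 'a \<Rightarrow> 'a \<Rightarrow> real" where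
  "alpha_weight \<alpha> G u v = (if u = v then \<alpha> * real (out_degree (with_proj G) u) else 0) +
    (if (u, v) \<in> parcs G then 1 - \<alpha> else 0)"

lemma A_alpha_carrier: "A_alpha \<alpha> G \<in> carrier_mat (card (pverts G)) (card (pverts G))"
  by (simp add: A_alpha_def degree_matrix_def adjacency_matrix_def Let_def)

lemma bij_betw_vertex_list:
  assumes "finite (pverts G)"
  shows "bij_betw (\<lambda>i. vertex_list G ! i) {0..<card (pverts G)} (pverts G)"
  using vertex_list[OF assms] distinct_card[of "vertex_list G"]
  by (intro bij_betw_nth) (simp_all add: lessThan_atLeast0)

lemma sum_vertex_list:
  assumes "finite (pverts G)"
  shows "(\<Sum>i\<in>{0..<card (pverts G)}. f (vertex_list G ! i)) = (\<Sum>v\<in>pverts G. f v)"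
  by (rule sum.reindex_bij_betw[OF bij_betw_vertex_list[OF assms]])

definition vertex_vec :: "'a pair_pre_digraph \<Rightarrow> ('a \<Rightarrow> 'b) \<Rightarrow> 'b vec" where
  "vertex_vec G x = vec (card (pverts G)) (\<lambda>i. x (vertex_list G ! i))"

lemma vertex_vec_carrier: "vertex_vec G x \<in> carrier_vec (card (pverts G))"
  by (simp add: vertex_vec_def)

lemma (in pair_wf_digraph) parcs_subset_Times: "parcs G \<subseteq> pverts G \<times> pverts G"
  by (auto dest: in_arcsD1 in_arcsD2)

context pair_fin_digraph
begin

lemma alpha_form_eq_sum_vertices:
  "alpha_form \<alpha> (parcs G) x = (\<Sum>u\<in>pverts G.
    x u * (\<alpha> * real (out_degree (with_proj G) u) * x u + (1 - \<alpha>) * (\<Sum>v | (u, v) \<in> parcs G. x v)))"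
proof -
  have "finite {v. (u, v) \<in> parcs G}" for u
    using parcs_subset_Times by (intro finite_subset[OF _ pair_finite_verts]) auto
  then have "(\<Sum>u\<in>pverts G. \<Sum>v | (u, v) \<in> parcs G. \<alpha> * (x u)\<^sup>2 + (1 - \<alpha>) * x u * x v) =
      alpha_form \<alpha> (SIGMA u:pverts G. {v. (u, v) \<in> parcs G}) x"
    unfolding alpha_form_def by (intro sum.Sigma pair_finite_verts) blast
  also have "(SIGMA u:pverts G. {v. (u, v) \<in> parcs G}) = parcs G"
    using parcs_subset_Times by auto
  finally have "alpha_form \<alpha> (parcs G) x =
      (\<Sum>u\<in>pverts G. \<Sum>v | (u, v) \<in> parcs G. \<alpha> * (x u)\<^sup>2 + (1 - \<alpha>) * x u * x v)"
    by (rule sym)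
  also have "\<dots> = (\<Sum>u\<in>pverts G.
      x u * (\<alpha> * real (out_degree (with_proj G) u) * x u + (1 - \<alpha>) * (\<Sum>v | (u, v) \<in> parcs G. x v)))"
    by (simp add: sum.distrib sum_distrib_left out_degree_with_proj power2_eq_square distrib_left
        mult_ac)
  finally show ?thesis .
qed

lemma A_alpha_index:
  assumes "i < card (pverts G)" and "j < card (pverts G)"
  shows "A_alpha \<alpha> G $$ (i, j) = alpha_weight \<alpha> G (vertex_list G ! i) (vertex_list G ! j)"
  using assms pair_finite_verts
    inj_on_eq_iff[OF bij_betw_imp_inj_on[OF bij_betw_vertex_list], of G i j]
  by (simp add: A_alpha_def degree_matrix_def adjacency_matrix_def Let_def alpha_weight_def)

lemma sum_alpha_weight:
  assumes "u \<in> pverts G"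
  shows "(\<Sum>v\<in>pverts G. alpha_weight \<alpha> G u v * x v) =
    \<alpha> * real (out_degree (with_proj G) u) * x u + (1 - \<alpha>) * (\<Sum>v | (u, v) \<in> parcs G. x v)"
proof -
  have "{v \<in> pverts G. (u, v) \<in> parcs G} = {v. (u, v) \<in> parcs G}"
    by (auto dest: in_arcsD2)
  then have "(\<Sum>v\<in>pverts G. (if (u, v) \<in> parcs G then (1 - \<alpha>) * x v else 0)) =
      (1 - \<alpha>) * (\<Sum>v | (u, v) \<in> parcs G. x v)"
    by (simp add: sum.inter_filter[OF pair_finite_verts, symmetric] sum_distrib_left)
  then show ?thesis
    using assms pair_finite_verts
    by (simp add: alpha_weight_def distrib_right sum.distrib if_distrib[of "\<lambda>c. c * _"]
        cong: if_cong)
qed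

lemma quadratic_form_A_alpha:
  "vertex_vec G x \<bullet> (A_alpha \<alpha> G *\<^sub>v vertex_vec G x) = alpha_form \<alpha> (parcs G) x"
proof -
  let ?n = "card (pverts G)" and ?vs = "vertex_list G"
  have "vertex_vec G x \<bullet> (A_alpha \<alpha> G *\<^sub>v vertex_vec G x) =
      (\<Sum>i\<in>{0..<?n}. x (?vs ! i) * (\<Sum>j\<in>{0..<?n}. alpha_weight \<alpha> G (?vs ! i) (?vs ! j) * x (?vs ! j)))"
    using A_alpha_carrier[of \<alpha> G]
    by (auto simp: vertex_vec_def scalar_prod_def A_alpha_index intro!: sum.cong)
  also have "\<dots> = (\<Sum>u\<in>pverts G. x u * (\<Sum>v\<in>pverts G. alpha_weight \<alpha> G u v * x v))"
    unfolding sum_vertex_list[OF pair_finite_verts, of "\<lambda>v. alpha_weight \<alpha> G _ v * x v"]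
    by (rule sum_vertex_list[OF pair_finite_verts])
  also have "\<dots> = alpha_form \<alpha> (parcs G) x"
    unfolding alpha_form_eq_sum_vertices by (intro sum.cong) (simp_all add: sum_alpha_weight)
  finally show ?thesis .
qed

lemma vertex_vec_scalar_prod_self:
  fixes x :: "'a \<Rightarrow> real"
  shows "vertex_vec G x \<bullet> vertex_vec G x = (\<Sum>v\<in>pverts G. (x v)\<^sup>2)"
  using sum_vertex_list[OF pair_finite_verts, of "\<lambda>v. (x v)\<^sup>2"]
  by (simp add: vertex_vec_def scalar_prod_def power2_eq_square)

end

context pair_pseudo_graph
begin

lemma A_alpha_symmetric: "transpose_mat (A_alpha \<alpha> G) = A_alpha \<alpha> G"
  using A_alpha_carrier[of \<alpha> G] arcs_symmetric
  by (intro eq_matI) (auto simp: A_alpha_index alpha_weight_def)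

lemma alpha_form_le_rho_alpha:
  assumes "pverts G \<noteq> {}"
  shows "alpha_form \<alpha> (parcs G) x \<le> rho_alpha \<alpha> G * (\<Sum>v\<in>pverts G. (x v)\<^sup>2)"
  using quadratic_form_le_Max_eigenvalue[OF A_alpha_carrier A_alpha_symmetric,
      of "vertex_vec G x" \<alpha>] assms pair_finite_verts
  by (simp add: rho_alpha_def card_gt_0_iff vertex_vec_carrier quadratic_form_A_alpha
      vertex_vec_scalar_prod_self)

lemma rho_alpha_attained:
  assumes "pverts G \<noteq> {}"
  obtains x where "0 < (\<Sum>v\<in>pverts G. (x v)\<^sup>2)"
    "alpha_form \<alpha> (parcs G) x = rho_alpha \<alpha> G * (\<Sum>v\<in>pverts G. (x v)\<^sup>2)"
proof -
  let ?n = "card (pverts G)"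
  note bij = bij_betw_vertex_list[OF pair_finite_verts]
  have "eigenvalue (A_alpha \<alpha> G) (rho_alpha \<alpha> G)"
    unfolding rho_alpha_def using assms pair_finite_verts
    by (intro eigenvalue_Max_symmetric[OF A_alpha_carrier A_alpha_symmetric])
      (simp add: card_gt_0_iff)
  then obtain w where w: "w \<in> carrier_vec ?n" "w \<noteq> 0\<^sub>v ?n"
    and eig: "A_alpha \<alpha> G *\<^sub>v w = rho_alpha \<alpha> G \<cdot>\<^sub>v w"
    using A_alpha_carrier[of \<alpha> G] by (auto simp: eigenvalue_def eigenvector_def)
  define x where "x v = w $ the_inv_into {0..<?n} (\<lambda>i. vertex_list G ! i) v" for v
  have x: "vertex_vec G x = w"
    using w(1) bij by (auto simp: x_def vertex_vec_def bij_betw_def the_inv_into_f_f)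
  have "w \<bullet> w = (\<Sum>v\<in>pverts G. (x v)\<^sup>2)"
    using vertex_vec_scalar_prod_self[of x] by (simp add: x)
  moreover have "w \<bullet> (A_alpha \<alpha> G *\<^sub>v w) = alpha_form \<alpha> (parcs G) x"
    using quadratic_form_A_alpha[of x] by (simp add: x)
  moreover have "0 < w \<bullet> w"
    using conjugate_square_greater_0_vec[OF w(1)] w(2) by simp
  ultimately show ?thesis
    using that[of x] w(1) by (simp add: eig)
qed

lemma rho_alpha_leI:
  assumes "pverts G \<noteq> {}"
    and "\<And>x. alpha_form \<alpha> (parcs G) x \<le> c * (\<Sum>v\<in>pverts G. (x v)\<^sup>2)"
  shows "rho_alpha \<alpha> G \<le> c"
  using rho_alpha_attained[OF assms(1)] assms(2) by (metis mult_le_cancel_right_pos)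

lemma rho_alpha_lessI:
  assumes "pverts G \<noteq> {}"
    and "\<And>x. 0 < (\<Sum>v\<in>pverts G. (x v)\<^sup>2) \<Longrightarrow>
      alpha_form \<alpha> (parcs G) x < c * (\<Sum>v\<in>pverts G. (x v)\<^sup>2)"
  shows "rho_alpha \<alpha> G < c"
  using rho_alpha_attained[OF assms(1)] assms(2) by (metis mult_less_cancel_right_pos)

lemma card_arcs_le_rho_alpha:
  assumes "pverts G \<noteq> {}"
  shows "real (card (parcs G)) \<le> rho_alpha \<alpha> G * real (card (pverts G))"
  using alpha_form_le_rho_alpha[OF assms, of \<alpha> "\<lambda>_. 1"]
  by (simp add: alpha_form_def case_prod_beta)

lemma rho_alpha_nonneg:
  assumes "pverts G \<noteq> {}"
  shows "0 \<le> rho_alpha \<alpha> G"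
proof -
  have "0 \<le> rho_alpha \<alpha> G * real (card (pverts G))"
    using card_arcs_le_rho_alpha[OF assms] by (rule order_trans[rotated]) simp
  then show ?thesis
    using assms pair_finite_verts by (simp add: zero_le_mult_iff card_gt_0_iff)
qed

end

section \<open>Embeddings and isomorphisms\<close>

lemma rho_alpha_mono_embedding:
  assumes "pair_pseudo_graph G" and "pair_pseudo_graph H" and "pverts G \<noteq> {}"
    and \<alpha>: "0 \<le> \<alpha>" "\<alpha> \<le> 1"
    and inj: "inj_on h (pverts G)" and verts: "h ` pverts G \<subseteq> pverts H"
    and arcs: "map_prod h h ` parcs G \<subseteq> parcs H"
  shows "rho_alpha \<alpha> G \<le> rho_alpha \<alpha> H"
proof -
  interpret G: pair_pseudo_graph G by fact
  interpret H: pair_pseudo_graph H by fact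
  show ?thesis
  proof (rule G.rho_alpha_leI[OF \<open>pverts G \<noteq> {}\<close>])
    fix x :: "'a \<Rightarrow> real"
    define y where "y w = (if w \<in> h ` pverts G then \<bar>x (the_inv_into (pverts G) h w)\<bar> else 0)" for w
    have y: "y (h v) = \<bar>x v\<bar>" if "v \<in> pverts G" for v
      using that inj by (simp add: y_def the_inv_into_f_f)
    have "alpha_form \<alpha> (parcs G) x \<le> alpha_form \<alpha> (parcs G) (\<lambda>v. \<bar>x v\<bar>)"
      using \<alpha>(2) by (rule alpha_form_le_abs)
    also have "\<dots> = alpha_form \<alpha> (parcs G) (y \<circ> h)"
      unfolding alpha_form_def
      using G.parcs_subset_Times by (intro sum.cong) (auto simp: y)
    also have "\<dots> = alpha_form \<alpha> (map_prod h h ` parcs G) y"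
      by (rule alpha_form_image[OF inj G.parcs_subset_Times, symmetric])
    also have "\<dots> \<le> alpha_form \<alpha> (parcs H) y"
      using H.pair_finite_arcs arcs \<alpha> by (intro alpha_form_mono) (simp_all add: y_def)
    also have "\<dots> \<le> rho_alpha \<alpha> H * (\<Sum>w\<in>pverts H. (y w)\<^sup>2)"
      using \<open>pverts G \<noteq> {}\<close> verts by (intro H.alpha_form_le_rho_alpha) auto
    also have "(\<Sum>w\<in>pverts H. (y w)\<^sup>2) = (\<Sum>w\<in>h ` pverts G. (y w)\<^sup>2)"
      using H.pair_finite_verts verts by (intro sum.mono_neutral_right) (auto simp: y_def)
    also have "\<dots> = (\<Sum>v\<in>pverts G. (x v)\<^sup>2)"
      by (simp add: sum.reindex[OF inj] y)
    finally show "alpha_form \<alpha> (parcs G) x \<le> rho_alpha \<alpha> H * (\<Sum>v\<in>pverts G. (x v)\<^sup>2)" .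
  qed
qed

lemma (in pair_wf_digraph) digraph_iso_with_proj_iff:
  "digraph_iso (with_proj G) (with_proj H) \<longleftrightarrow>
    (\<exists>h. inj_on h (pverts G) \<and> pverts H = h ` pverts G \<and> parcs H = map_prod h h ` parcs G)"
proof
  assume "digraph_iso (with_proj G) (with_proj H)"
  then obtain f where f: "digraph_isomorphism f" and H: "with_proj H = app_iso f (with_proj G)"
    by (auto simp: digraph_iso_def)
  have "iso_tail f = fst" "iso_head f = snd"
    using arg_cong[OF H, of tail] arg_cong[OF H, of head] by simp_all
  then have "iso_arcs f e = map_prod (iso_verts f) (iso_verts f) e" if "e \<in> parcs G" for e
    using f that by (simp add: digraph_isomorphism_def prod_eq_iff)
  then have "iso_arcs f ` parcs G = map_prod (iso_verts f) (iso_verts f) ` parcs G"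
    by (rule image_cong[OF refl])
  moreover have "pverts H = iso_verts f ` pverts G" "parcs H = iso_arcs f ` parcs G"
    using arg_cong[OF H, of verts] arg_cong[OF H, of arcs] by simp_all
  moreover have "inj_on (iso_verts f) (pverts G)"
    using digraph_isomorphism_inj_on_verts[OF f] by simp
  ultimately show "\<exists>h. inj_on h (pverts G) \<and> pverts H = h ` pverts G \<and>
      parcs H = map_prod h h ` parcs G"
    by auto
next
  assume "\<exists>h. inj_on h (pverts G) \<and> pverts H = h ` pverts G \<and> parcs H = map_prod h h ` parcs G"
  then obtain h where h: "inj_on h (pverts G)"
    and H: "pverts H = h ` pverts G" "parcs H = map_prod h h ` parcs G"
    by blast
  define f where "f = \<lparr>iso_verts = h, iso_arcs = map_prod h h, iso_head = snd, iso_tail = fst\<rparr>"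
  have "inj_on (map_prod h h) (parcs G)"
    using map_prod_inj_on[OF h h] parcs_subset_Times by (rule inj_on_subset)
  then have "digraph_isomorphism f"
    using h wf_digraph_axioms by (auto simp: digraph_isomorphism_def f_def)
  moreover have "with_proj H = app_iso f (with_proj G)"
    using H by (simp add: with_proj_def app_iso_def f_def)
  ultimately show "digraph_iso (with_proj G) (with_proj H)"
    unfolding digraph_iso_def by blast
qed

lemma rho_alpha_iso_le:
  assumes "pair_pseudo_graph G" and "pair_pseudo_graph H" and "pverts G \<noteq> {}"
    and "0 \<le> \<alpha>" "\<alpha> \<le> 1" and "digraph_iso (with_proj G) (with_proj H)"
  shows "rho_alpha \<alpha> G \<le> rho_alpha \<alpha> H"
proof -
  interpret G: pair_pseudo_graph G by fact
  show ?thesis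
    using assms(6) rho_alpha_mono_embedding[OF assms(1-5)]
    unfolding G.digraph_iso_with_proj_iff by blast
qed

lemma max_degree_iso:
  assumes "digraph_iso (with_proj G) (with_proj H)"
  shows "max_degree G = max_degree H"
proof -
  obtain f where f: "pre_digraph.digraph_isomorphism (with_proj G) f"
    and H: "with_proj H = app_iso f (with_proj G)"
    using assms by (auto simp: digraph_iso_def)
  have wf: "wf_digraph (with_proj G)"
    using f by (simp add: pre_digraph.digraph_isomorphism_def)
  have "pverts H = iso_verts f ` pverts G"
    using arg_cong[OF H, of verts] by simp
  then have "out_degree (with_proj H) ` pverts H = out_degree (with_proj G) ` pverts G"
    using wf_digraph.out_degree_app_iso_eq[OF wf f] by (simp add: H image_image)
  then show ?thesis
    by (simp add: max_degree_def)
qed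

lemma gamma_alpha_iso:
  assumes "pair_pseudo_graph G" and "pair_pseudo_graph H" and "pverts G \<noteq> {}"
    and "0 \<le> \<alpha>" "\<alpha> \<le> 1" and "digraph_iso (with_proj G) (with_proj H)"
  shows "gamma_alpha \<alpha> G = gamma_alpha \<alpha> H"
proof -
  interpret G: pair_pseudo_graph G by fact
  have "digraph_iso (with_proj H) (with_proj G)"
    using assms(6) G.wf_digraph_axioms by (rule digraph_iso_swap[rotated])
  moreover have "pverts H \<noteq> {}"
    using assms(3,6) unfolding G.digraph_iso_with_proj_iff by auto
  ultimately have "rho_alpha \<alpha> G = rho_alpha \<alpha> H"
    using assms by (intro antisym rho_alpha_iso_le)
  then show ?thesis
    using max_degree_iso[OF assms(6)] by (simp add: gamma_alpha_def)
qed

section \<open>Degrees and stars\<close>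

lemma (in pair_fin_digraph) obtain_max_degree_vertex:
  assumes "pverts G \<noteq> {}"
  obtains z where "z \<in> pverts G" "out_degree (with_proj G) z = max_degree G"
  using Max_in[of "out_degree (with_proj G) ` pverts G"] assms pair_finite_verts
  unfolding max_degree_def by (metis (no_types, lifting) finite_imageI imageE image_is_empty)

context pair_digraph
begin

lemma out_degree_less_card:
  assumes "v \<in> pverts G"
  shows "out_degree (with_proj G) v < card (pverts G)"
  unfolding out_degree_with_proj
  using assms pair_finite_verts by (intro psubset_card_mono) (auto dest: in_arcsD2 no_loops')

lemma max_degree_less_card:
  assumes "pverts G \<noteq> {}"
  shows "max_degree G < card (pverts G)"
  using obtain_max_degree_vertex[OF assms] out_degree_less_card by metis

lemma dominating_vertex_max_degree:
  assumes "z \<in> pverts G" and "out_degree (with_proj G) z = card (pverts G) - 1"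
  shows "max_degree G = card (pverts G) - 1"
proof (rule antisym)
  show "max_degree G \<le> card (pverts G) - 1"
    using max_degree_less_card assms(1) by fastforce
  show "card (pverts G) - 1 \<le> max_degree G"
    unfolding max_degree_def assms(2)[symmetric] using assms(1) pair_finite_verts by simp
qed

end

lemma pair_graph_star_graph: "pair_graph (star_graph n)"
proof unfold_locales
  show "finite (parcs (star_graph n))"
    by (simp add: star_graph_def)
  show "symmetric (with_proj (star_graph n))"
    by (auto simp: symmetric_def sym_def star_graph_def)
qed (auto simp: star_graph_def)

lemma pair_graph_star_plus_edge:
  assumes "n \<ge> 3"
  shows "pair_graph (star_plus_edge n)"
proof unfold_locales
  show "finite (parcs (star_plus_edge n))"
    by (simp add: star_plus_edge_def star_graph_def)
  show "symmetric (with_proj (star_plus_edge n))"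
    by (auto simp: symmetric_def sym_def star_plus_edge_def star_graph_def)
qed (use assms in \<open>auto simp: star_plus_edge_def star_graph_def\<close>)

lemma pverts_star [simp]:
  "pverts (star_graph n) = {0..<n}" "pverts (star_plus_edge n) = {0..<n}"
  by (simp_all add: star_graph_def star_plus_edge_def)

lemma max_degree_star_graph:
  assumes "n \<ge> 1"
  shows "max_degree (star_graph n) = n - 1"
proof -
  interpret pair_graph "star_graph n" by (rule pair_graph_star_graph)
  have "{w. (0, w) \<in> parcs (star_graph n)} = {1..<n}"
    by (auto simp: star_graph_def)
  then show ?thesis
    using dominating_vertex_max_degree[of 0] assms by (simp add: out_degree_with_proj)
qed

lemma max_degree_star_plus_edge:
  assumes "n \<ge> 3"
  shows "max_degree (star_plus_edge n) = n - 1"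
proof -
  interpret pair_graph "star_plus_edge n" using assms by (rule pair_graph_star_plus_edge)
  have "{w. (0, w) \<in> parcs (star_plus_edge n)} = {1..<n}"
    by (auto simp: star_plus_edge_def star_graph_def)
  then show ?thesis
    using dominating_vertex_max_degree[of 0] assms by (simp add: out_degree_with_proj)
qed

lemma (in pair_graph) rho_alpha_star_graph_out_degree_le:
  assumes z: "z \<in> pverts G" and "0 \<le> \<alpha>" "\<alpha> \<le> 1"
  shows "rho_alpha \<alpha> (star_graph (Suc (out_degree (with_proj G) z))) \<le> rho_alpha \<alpha> G"
proof -
  define d where "d = out_degree (with_proj G) z"
  interpret S: pair_graph "star_graph (Suc d)" by (rule pair_graph_star_graph)
  define N where "N = {w. (z, w) \<in> parcs G}"
  have N: "N \<subseteq> pverts G - {z}"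
    by (auto simp: N_def dest: in_arcsD2 no_loops')
  then have "finite N"
    using pair_finite_verts by (auto intro: finite_subset)
  then obtain h where h: "bij_betw h {1..<Suc d} N"
    using finite_same_card_bij[of "{1..<Suc d}" N] by (auto simp: d_def N_def out_degree_with_proj)
  define k where "k = h(0 := z)"
  have "bij_betw k {1..<Suc d} N \<longleftrightarrow> bij_betw h {1..<Suc d} N"
    by (intro bij_betw_cong) (simp add: k_def)
  then have k: "k 0 = z" "bij_betw k {1..<Suc d} N"
    using h by (simp_all add: k_def)
  have verts: "{0..<Suc d} = insert 0 {1..<Suc d}"
    by auto
  have kN: "k i \<in> N" if "i \<in> {1..<Suc d}" for i
    using k(2) that by (auto simp: bij_betw_def)
  show ?thesis
    unfolding d_def[symmetric]
  proof (rule rho_alpha_mono_embedding[OF S.pair_pseudo_graph pair_pseudo_graph _ assms(2,3)])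
    show "inj_on k (pverts (star_graph (Suc d)))"
      using k N unfolding pverts_star verts by (auto simp: bij_betw_def)
    show "k ` pverts (star_graph (Suc d)) \<subseteq> pverts G"
      using k N z unfolding pverts_star verts by (auto simp: bij_betw_def)
    show "map_prod k k ` parcs (star_graph (Suc d)) \<subseteq> parcs G"
      using kN k(1) arcs_symmetric unfolding star_graph_def N_def by auto
  qed simp
qed

lemma (in pair_graph) gamma_alpha_le_star_graph:
  assumes "pverts G \<noteq> {}" and "0 \<le> \<alpha>" "\<alpha> \<le> 1"
  shows "gamma_alpha \<alpha> G \<le> gamma_alpha \<alpha> (star_graph (Suc (max_degree G)))"
proof -
  obtain z where "z \<in> pverts G" "out_degree (with_proj G) z = max_degree G"
    using obtain_max_degree_vertex[OF assms(1)] .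
  then show ?thesis
    using rho_alpha_star_graph_out_degree_le[of z \<alpha>] assms(2,3)
    by (simp add: gamma_alpha_def max_degree_star_graph)
qed

lemma alpha_form_star_graph_Suc:
  assumes "n \<ge> 1"
  shows "alpha_form \<alpha> (parcs (star_graph (Suc n))) x =
    alpha_form \<alpha> (parcs (star_graph n)) x + ((x 0)\<^sup>2 + (x n)\<^sup>2 - (1 - \<alpha>) * (x 0 - x n)\<^sup>2)"
proof -
  have "parcs (star_graph (Suc n)) = insert (0, n) (insert (n, 0) (parcs (star_graph n)))"
    using assms by (auto simp: star_graph_def)
  then show ?thesis
    using assms by (subst alpha_form_insert_edge[symmetric]) (auto simp: star_graph_def)
qed

lemma alpha_form_star_graph_centre_zero:
  assumes "n \<ge> 1" and "x 0 = 0"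
  shows "alpha_form \<alpha> (parcs (star_graph n)) x = \<alpha> * (\<Sum>i\<in>{0..<n}. (x i)\<^sup>2)"
  using assms(1)
proof (induction n rule: nat_induct_at_least)
  case base
  then show ?case using assms(2) by (simp add: alpha_form_def star_graph_def)
next
  case (Suc n)
  then show ?case using assms(2) by (simp add: alpha_form_star_graph_Suc algebra_simps)
qed

lemma alpha_form_star_plus_edge:
  "alpha_form \<alpha> (parcs (star_plus_edge n)) x =
    alpha_form \<alpha> (parcs (star_graph n)) x + ((x 1)\<^sup>2 + (x 2)\<^sup>2 - (1 - \<alpha>) * (x 1 - x 2)\<^sup>2)"
proof -
  have "parcs (star_plus_edge n) = insert (1, 2) (insert (2, 1) (parcs (star_graph n)))"
    by (simp add: star_plus_edge_def)
  then show ?thesis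
    by (simp only:) (rule alpha_form_insert_edge, auto simp: star_graph_def)
qed

lemma rho_alpha_star_graph_Suc_le:
  assumes "n \<ge> 1" and "\<alpha> \<le> 1"
  shows "rho_alpha \<alpha> (star_graph (Suc n)) \<le> rho_alpha \<alpha> (star_graph n) + 1"
proof -
  interpret S: pair_graph "star_graph n" by (rule pair_graph_star_graph)
  interpret S': pair_graph "star_graph (Suc n)" by (rule pair_graph_star_graph)
  define \<rho> where "\<rho> = rho_alpha \<alpha> (star_graph n)"
  have "alpha_form \<alpha> (parcs (star_graph (Suc n))) x \<le> (\<rho> + 1) * (\<Sum>i\<in>{0..<Suc n}. (x i)\<^sup>2)" for x
  proof -
    define s where "s = (\<Sum>i\<in>{0..<n}. (x i)\<^sup>2)"
    have "alpha_form \<alpha> (parcs (star_graph n)) x \<le> \<rho> * s"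
      using S.alpha_form_le_rho_alpha[of \<alpha> x] assms(1) by (simp add: \<rho>_def s_def)
    moreover have "(x 0)\<^sup>2 \<le> s"
      unfolding s_def using assms(1) by (intro member_le_sum) auto
    moreover have "0 \<le> (1 - \<alpha>) * (x 0 - x n)\<^sup>2"
      using assms(2) by simp
    moreover have "0 \<le> \<rho> * (x n)\<^sup>2"
      using S.rho_alpha_nonneg[of \<alpha>] assms(1) by (simp add: \<rho>_def)
    ultimately show ?thesis
      using assms(1)
      by (simp add: alpha_form_star_graph_Suc s_def[symmetric] distrib_left distrib_right)
  qed
  then show ?thesis
    unfolding \<rho>_def by (intro S'.rho_alpha_leI) simp_all
qed

lemma gamma_alpha_star_graph_mono:
  assumes "1 \<le> m" and "m \<le> n" and "\<alpha> \<le> 1"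
  shows "gamma_alpha \<alpha> (star_graph m) \<le> gamma_alpha \<alpha> (star_graph n)"
  using assms(2)
proof (induction n rule: dec_induct)
  case base
  show ?case ..
next
  case (step n)
  then have "gamma_alpha \<alpha> (star_graph n) \<le> gamma_alpha \<alpha> (star_graph (Suc n))"
    using rho_alpha_star_graph_Suc_le[of n \<alpha>] assms(1,3)
    by (simp add: gamma_alpha_def max_degree_star_graph of_nat_diff)
  with step.IH show ?case by (rule order_trans)
qed

lemma rho_alpha_star_graph_ge_1:
  assumes "n \<ge> 2"
  shows "1 \<le> rho_alpha \<alpha> (star_graph n)"
proof -
  interpret pair_graph "star_graph n" by (rule pair_graph_star_graph)
  have "card (parcs (star_graph n)) = 2 * (n - 1)"
    unfolding star_graph_def by (subst pair_pre_digraph.select_convs, subst card_Un_disjoint) auto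
  then have "2 * (real n - 1) \<le> rho_alpha \<alpha> (star_graph n) * real n"
    using card_arcs_le_rho_alpha[of \<alpha>] assms by (simp add: of_nat_diff)
  moreover have "1 * real n \<le> 2 * (real n - 1)"
    using assms by simp
  ultimately have "1 * real n \<le> rho_alpha \<alpha> (star_graph n) * real n"
    by (rule order_trans[rotated])
  then show ?thesis
    using assms by (subst (asm) mult_le_cancel_right_pos) simp_all
qed

lemma alpha_form_star_plus_edge_Suc_le:
  assumes "m \<ge> 3" and "\<alpha> \<le> 1"
  shows "alpha_form \<alpha> (parcs (star_plus_edge (Suc m))) x \<le>
    alpha_form \<alpha> (parcs (star_graph m)) x + (\<Sum>i\<in>{0..<Suc m}. (x i)\<^sup>2) - (1 - \<alpha>) * (x 0 - x m)\<^sup>2"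
proof -
  have "(\<Sum>i\<in>{0, 1, 2}. (x i)\<^sup>2) \<le> (\<Sum>i\<in>{0..<m}. (x i)\<^sup>2)"
    using assms(1) by (intro sum_mono2) auto
  moreover have "0 \<le> (1 - \<alpha>) * (x 1 - x 2)\<^sup>2"
    using assms(2) by simp
  ultimately show ?thesis
    using assms(1) by (simp add: alpha_form_star_plus_edge alpha_form_star_graph_Suc)
qed

lemma rho_alpha_star_plus_edge_less:
  assumes m: "m \<ge> 3" and \<alpha>: "\<alpha> < 1"
  shows "rho_alpha \<alpha> (star_plus_edge (Suc m)) < rho_alpha \<alpha> (star_graph m) + 1"
proof -
  interpret S: pair_graph "star_graph m" by (rule pair_graph_star_graph)
  interpret H: pair_graph "star_plus_edge (Suc m)" using m by (intro pair_graph_star_plus_edge) simp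
  define \<rho> where "\<rho> = rho_alpha \<alpha> (star_graph m)"
  have \<rho>: "1 \<le> \<rho>"
    unfolding \<rho>_def using m by (intro rho_alpha_star_graph_ge_1) simp
  have "alpha_form \<alpha> (parcs (star_plus_edge (Suc m))) x < (\<rho> + 1) * (\<Sum>i\<in>{0..<Suc m}. (x i)\<^sup>2)"
    if pos: "0 < (\<Sum>i\<in>{0..<Suc m}. (x i)\<^sup>2)" for x
  proof -
    define s where "s = (\<Sum>i\<in>{0..<m}. (x i)\<^sup>2)"
    have "alpha_form \<alpha> (parcs (star_graph m)) x < \<rho> * (s + (x m)\<^sup>2) + (1 - \<alpha>) * (x 0 - x m)\<^sup>2"
    proof (cases "x 0 = 0 \<and> x m = 0")
      case True
      then have "\<alpha> * s < \<rho> * s"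
        using pos \<alpha> \<rho> by (simp add: s_def)
      then show ?thesis
        using True m by (simp add: alpha_form_star_graph_centre_zero s_def)
    next
      case False
      then have "0 < \<rho> * (x m)\<^sup>2 + (1 - \<alpha>) * (x 0 - x m)\<^sup>2"
        using \<alpha> \<rho> by (cases "x m = 0") (simp_all add: add_pos_nonneg)
      then show ?thesis
        using S.alpha_form_le_rho_alpha[of \<alpha> x] m by (simp add: \<rho>_def s_def distrib_left)
    qed
    then show ?thesis
      using alpha_form_star_plus_edge_Suc_le[of m \<alpha> x] m \<alpha> by (simp add: s_def distrib_right)
  qed
  then show ?thesis
    unfolding \<rho>_def[symmetric] by (intro H.rho_alpha_lessI) simp_all
qed

lemma gamma_alpha_star_graph_less_star_plus_edge:
  assumes "m \<ge> 3" and "\<alpha> < 1"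
  shows "gamma_alpha \<alpha> (star_graph m) < gamma_alpha \<alpha> (star_plus_edge (Suc m))"
  using rho_alpha_star_plus_edge_less[OF assms] assms(1)
  by (simp add: gamma_alpha_def max_degree_star_graph max_degree_star_plus_edge)

lemma (in pair_graph) gamma_alpha_less_star_plus_edge:
  assumes "card (pverts G) = n" and "n \<ge> 4" and "0 \<le> \<alpha>" "\<alpha> < 1" and "max_degree G < n - 1"
  shows "gamma_alpha \<alpha> G < gamma_alpha \<alpha> (star_plus_edge n)"
proof -
  have "gamma_alpha \<alpha> G \<le> gamma_alpha \<alpha> (star_graph (Suc (max_degree G)))"
    using assms(1-4) by (intro gamma_alpha_le_star_graph) auto
  also have "\<dots> \<le> gamma_alpha \<alpha> (star_graph (n - 1))"
    using assms(4,5) by (intro gamma_alpha_star_graph_mono) simp_all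
  also have "\<dots> < gamma_alpha \<alpha> (star_plus_edge n)"
    using gamma_alpha_star_graph_less_star_plus_edge[of "n - 1" \<alpha>] assms(2,4) by simp
  finally show ?thesis .
qed

section \<open>Unicyclic graphs with a dominating vertex\<close>

context pair_loopfree_digraph
begin

lemma cycle_arc_avoiding_vertex:
  assumes "cycle p" and "3 \<le> length p"
  obtains x y where "(x, y) \<in> parcs G" "x \<noteq> z" "y \<noteq> z"
proof -
  obtain u where u: "awalk u p u" "distinct (tl (pawalk_verts u p))"
    using assms(1) by (auto simp: cycle_def)
  obtain a b c d q where p: "p = (a, b) # (b, c) # (c, d) # q" and "a = u"
    using u(1) assms(2) by (auto simp: awalk_def numeral_3_eq_3 Suc_le_length_iff)
  have arcs: "(a, b) \<in> parcs G" "(b, c) \<in> parcs G" "(c, d) \<in> parcs G"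
    using u(1) by (auto simp: p awalk_def)
  have "awalk d q u"
    using u(1) by (auto simp: p awalk_Cons_iff)
  then have "d \<in> set (awalk_verts d q)" "u \<in> set (awalk_verts d q)"
    by (auto simp: hd_in_awalk_verts simp del: awalk_verts_with_proj_eq elim: awalkE)
  then have "b \<noteq> d" "a \<noteq> c"
    using u(2) \<open>a = u\<close> by (auto simp: p)
  moreover have "a \<noteq> b" "b \<noteq> c" "c \<noteq> d"
    using arcs no_loops' by auto
  moreover consider "z = b" | "z = c" | "z \<noteq> b" "z \<noteq> c"
    by blast
  ultimately show ?thesis
    using arcs that by cases auto
qed

lemma triangle_in_undirected_cycles:
  assumes "(z, x) \<in> parcs G" "(x, y) \<in> parcs G" "(y, z) \<in> parcs G"
  shows "{{z, x}, {x, y}, {y, z}} \<in> undirected_cycles G"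
proof -
  have "x \<noteq> z" "x \<noteq> y" "y \<noteq> z"
    using assms no_loops' by auto
  then have "cycle [(z, x), (x, y), (y, z)]"
    using assms in_arcsD1 in_arcsD2
    by (auto simp: cycle_def awalk_def intro!: exI[of _ z])
  then show ?thesis
    unfolding undirected_cycles_def by (force intro!: exI[of _ "[(z, x), (x, y), (y, z)]"])
qed

end

lemma (in pair_graph) dominating_vertex_arc_iff:
  assumes "z \<in> pverts G" and "out_degree (with_proj G) z = card (pverts G) - 1"
  shows "(z, w) \<in> parcs G \<longleftrightarrow> w \<in> pverts G - {z}"
    and "(w, z) \<in> parcs G \<longleftrightarrow> w \<in> pverts G - {z}"
proof -
  have "{w. (z, w) \<in> parcs G} = pverts G - {z}"
    using assms pair_finite_verts
    by (intro card_subset_eq) (auto simp: out_degree_with_proj dest: in_arcsD2 no_loops')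
  then show "(z, w) \<in> parcs G \<longleftrightarrow> w \<in> pverts G - {z}"
    by blast
  then show "(w, z) \<in> parcs G \<longleftrightarrow> w \<in> pverts G - {z}"
    using arcs_symmetric by blast
qed

lemma unicyclic_dominating_vertex_parcs:
  assumes uni: "unicyclic G"
    and z: "z \<in> pverts G" "out_degree (with_proj G) z = card (pverts G) - 1"
  obtains x y where "x \<in> pverts G - {z}" "y \<in> pverts G - {z}" "x \<noteq> y"
    "parcs G = {z} \<times> (pverts G - {z}) \<union> (pverts G - {z}) \<times> {z} \<union> {(x, y), (y, x)}"
proof -
  interpret pair_graph G using uni by (simp add: unicyclic_def)
  obtain C where C: "C \<in> undirected_cycles G"
    and C_unique: "\<And>D. D \<in> undirected_cycles G \<Longrightarrow> D = C"
    using uni by (auto simp: unicyclic_def)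
  note star_arcs = dominating_vertex_arc_iff[OF z]
  obtain p where "cycle p" "3 \<le> length p"
    using C by (auto simp: undirected_cycles_def)
  then obtain x y where xy: "(x, y) \<in> parcs G" "x \<noteq> z" "y \<noteq> z"
    by (rule cycle_arc_avoiding_vertex)
  have triangle: "{{z, u}, {u, v}, {v, z}} = C" if "(u, v) \<in> parcs G" "u \<noteq> z" "v \<noteq> z" for u v
    using that in_arcsD1[OF that(1)] in_arcsD2[OF that(1)]
    by (intro C_unique triangle_in_undirected_cycles) (simp_all add: star_arcs)
  have avoiding: "(u, v) \<in> {(x, y), (y, x)}" if uv: "(u, v) \<in> parcs G" "u \<noteq> z" "v \<noteq> z" for u v
  proof -
    have "{u, v} \<in> {{z, x}, {x, y}, {y, z}}"
      unfolding triangle[OF xy] triangle[OF uv, symmetric] by simp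
    then show ?thesis
      using uv by (auto simp: doubleton_eq_iff)
  qed
  have "parcs G = {z} \<times> (pverts G - {z}) \<union> (pverts G - {z}) \<times> {z} \<union> {(x, y), (y, x)}"
    (is "_ = ?arcs")
  proof (intro equalityI subrelI)
    fix u v assume "(u, v) \<in> parcs G"
    then show "(u, v) \<in> ?arcs"
      using star_arcs avoiding by (cases "u = z \<or> v = z") auto
  next
    fix u v assume "(u, v) \<in> ?arcs"
    then show "(u, v) \<in> parcs G"
      using star_arcs xy(1) arcs_symmetric by blast
  qed
  then show ?thesis
    using that xy in_arcsD1[OF xy(1)] in_arcsD2[OF xy(1)] no_loops'[OF xy(1)] by blast
qed

lemma (in pair_fin_digraph) digraph_iso_star_plus_edgeI:
  assumes z: "z \<in> pverts G" and x: "x \<in> pverts G - {z}" and y: "y \<in> pverts G - {z}" and "x \<noteq> y"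
    and arcs: "parcs G = {z} \<times> (pverts G - {z}) \<union> (pverts G - {z}) \<times> {z} \<union> {(x, y), (y, x)}"
  shows "digraph_iso (with_proj G) (with_proj (star_plus_edge (card (pverts G))))"
proof -
  define n where "n = card (pverts G)"
  define R where "R = pverts G - {z, x, y}"
  have "card R = n - 3" and n: "n \<ge> 3"
    using z x y \<open>x \<noteq> y\<close> pair_finite_verts card_mono[of "pverts G" "{z, x, y}"]
    by (auto simp: R_def n_def card_Diff_subset)
  then obtain h where h: "bij_betw h R {3..<n}"
    using finite_same_card_bij[of R "{3..<n}"] pair_finite_verts by (auto simp: R_def)
  define k where "k = h(z := 0, x := 1, y := 2)"
  have k_simps: "k z = 0" "k x = 1" "k y = 2"
    using x y \<open>x \<noteq> y\<close> by (auto simp: k_def)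
  have "k ` R = h ` R"
    by (intro image_cong) (auto simp: k_def R_def)
  then have "k ` R = {3..<n}"
    using h by (simp add: bij_betw_def)
  moreover have "pverts G = insert z (insert x (insert y R))"
    using z x y by (auto simp: R_def)
  ultimately have image_k: "k ` pverts G = {0..<n}"
    using n by (auto simp: k_simps)
  then have inj: "inj_on k (pverts G)"
    using pair_finite_verts by (intro eq_card_imp_inj_on) (simp_all add: n_def)
  have "k ` (pverts G - {z}) = {1..<n}"
    using inj_on_image_set_diff[OF inj, of "pverts G" "{z}"] z by (auto simp: image_k k_simps)
  then have "map_prod k k ` parcs G = parcs (star_plus_edge n)"
    unfolding arcs by (simp add: image_Un map_prod_surj_on k_simps star_plus_edge_def star_graph_def)
  then show ?thesis
    unfolding digraph_iso_with_proj_iff n_def[symmetric] using inj image_k by (intro exI[of _ k]) simp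
qed

lemma unicyclic_max_degree_iso:
  assumes "unicyclic G" and "pverts G \<noteq> {}" and "max_degree G = card (pverts G) - 1"
  shows "digraph_iso (with_proj G) (with_proj (star_plus_edge (card (pverts G))))"
proof -
  interpret pair_graph G using assms(1) by (simp add: unicyclic_def)
  obtain z where z: "z \<in> pverts G" "out_degree (with_proj G) z = card (pverts G) - 1"
    using obtain_max_degree_vertex[OF assms(2)] assms(3) by metis
  then show ?thesis
    using unicyclic_dominating_vertex_parcs[OF assms(1) z] digraph_iso_star_plus_edgeI[OF z(1)]
    by metis
qed

theorem theorem4p2:
  fixes G :: "'a pair_pre_digraph" and n :: nat and \<alpha> :: real
  assumes "unicyclic G" and "card (pverts G) = n" and "n \<ge> 4"
    and "0 \<le> \<alpha>" and "\<alpha> < 1"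
  shows "gamma_alpha \<alpha> G \<le> gamma_alpha \<alpha> (star_plus_edge n) \<and>
    (gamma_alpha \<alpha> G = gamma_alpha \<alpha> (star_plus_edge n) \<longleftrightarrow>
      digraph_iso (with_proj G) (with_proj (star_plus_edge n)))"
proof -
  interpret G: pair_graph G using assms(1) by (simp add: unicyclic_def)
  interpret H: pair_graph "star_plus_edge n"
    using assms(3) by (intro pair_graph_star_plus_edge) simp
  have nonempty: "pverts G \<noteq> {}" using assms(2,3) by auto
  have iso_eq: "gamma_alpha \<alpha> G = gamma_alpha \<alpha> (star_plus_edge n)"
    if "digraph_iso (with_proj G) (with_proj (star_plus_edge n))"
    using gamma_alpha_iso[OF G.pair_pseudo_graph H.pair_pseudo_graph nonempty] that assms(4,5)
    by simp
  show ?thesis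
  proof (cases "max_degree G = n - 1")
    case True
    then show ?thesis
      using unicyclic_max_degree_iso[OF assms(1) nonempty] iso_eq assms(2) by simp
  next
    case False
    then have "max_degree G < n - 1"
      using G.max_degree_less_card[OF nonempty] assms(2) by simp
    then show ?thesis
      using G.gamma_alpha_less_star_plus_edge[OF assms(2-5)] iso_eq by auto
  qed
qed

end
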